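(* Let $\Gamma$ be a tree, with positive integer weights $\mathbf k=\{k_v\}_{v\in V(\Gamma)}$. Let $u(v)$ be the valence of the vertex $v\in V(\Gamma)$. Then the order $t(\Gamma,\mathbf k)$ of the torsion subgroup of $H^1(\Gamma,\mathbf k)$ is $$t(\Gamma,\mathbf k)=\mathrm{GCD}(k_v\mid v\in V(\Gamma))\prod_{v\in V(\Gamma)}k_v^{\,u(v)-1}.$$
   Context: Graphs are finite, without loops or multiple edges. $H^*(\Gamma,\mathbf k)$ is the cohomology of the cochain complex $C^*(\Gamma,\mathbf k)$ with $C^0=\mathbf Z[V(\Gamma)]$, $C^1=\mathbf Z[E(\Gamma)]$ and only nontrivial differential $d^0(v)=\sum_{w} k_w\, e(v,w)$, the sum over neighbours $w$ of $v$, $e(v,w)$ being the edge joining $v$ and $w$. *)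

theory Defs
  imports Complex_Main "HOL-Algebra.Free_Abelian_Groups" "Graph_Theory.Digraph_Component"
begin

text \<open>
  The locale \<open>graph\<close> models finite simple graphs as symmetric digraphs, so that an undirected edge
  is a pair of opposite arcs. The predicates \<open>forest\<close> and \<open>tree\<close> of that library are not usable
  for these graphs: they count the closed walk a, b, a as a cycle. A cycle of the underlying
  undirected graph is a library cycle of length at least three. \<open>connected\<close> includes that there is
  at least one vertex.
\<close>

definition tree_graph :: "('a, 'b) pre_digraph \<Rightarrow> bool" where
  "tree_graph G \<longleftrightarrow>
     graph G \<and> Digraph_Component.connected G \<and> \<not> (\<exists>p. pre_digraph.cycle G p \<and> 3 \<le> length p)"

definition edges :: "('a, 'b) pre_digraph \<Rightarrow> 'a set set" where
  "edges G = (\<lambda>a. {tail G a, head G a}) ` arcs G"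

definition neighbours :: "('a, 'b) pre_digraph \<Rightarrow> 'a \<Rightarrow> 'a set" where
  "neighbours G v = {w. v \<rightarrow>\<^bsub>G\<^esub> w}"

definition valence :: "('a, 'b) pre_digraph \<Rightarrow> 'a \<Rightarrow> nat" where
  "valence G v = card (neighbours G v)"

definition cochain0 :: "('a, 'b) pre_digraph \<Rightarrow> ('a \<Rightarrow>\<^sub>0 int) monoid" where
  "cochain0 G = free_Abelian_group (verts G)"

definition cochain1 :: "('a, 'b) pre_digraph \<Rightarrow> ('a set \<Rightarrow>\<^sub>0 int) monoid" where
  "cochain1 G = free_Abelian_group (edges G)"

text \<open>The generator of an edge joining \<open>v\<close> and \<open>w\<close> is \<^term>\<open>frag_of {v, w}\<close>.\<close>

definition coboundary :: "('a, 'b) pre_digraph \<Rightarrow> ('a \<Rightarrow> nat) \<Rightarrow> ('a \<Rightarrow>\<^sub>0 int) \<Rightarrow> ('a set \<Rightarrow>\<^sub>0 int)" where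
  "coboundary G k =
     frag_extend (\<lambda>v. \<Sum>w\<in>neighbours G v. frag_cmul (int (k w)) (frag_of {v, w}))"

text \<open>
  The differential leaving \<^const>\<open>cochain1\<close> is zero, so every 1-cochain is a cocycle and the first
  cohomology group is the cokernel of \<^const>\<open>coboundary\<close>.
\<close>

definition cohomology1 ::
  "('a, 'b) pre_digraph \<Rightarrow> ('a \<Rightarrow> nat) \<Rightarrow> ('a set \<Rightarrow>\<^sub>0 int) set monoid" where
  "cohomology1 G k = cochain1 G Mod (coboundary G k ` carrier (cochain0 G))"

definition torsion_subgroup :: "('g, 'm) monoid_scheme \<Rightarrow> 'g set" where
  "torsion_subgroup A = {x \<in> carrier A. \<exists>n::nat. 0 < n \<and> x [^]\<^bsub>A\<^esub> n = \<one>\<^bsub>A\<^esub>}"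

lemma coboundary_frag_of:
  "coboundary G k (frag_of v) = (\<Sum>w\<in>neighbours G v. frag_cmul (int (k w)) (frag_of {v, w}))"
  by (simp add: coboundary_def)

lemma coboundary_hom: "coboundary G k \<in> hom (cochain0 G) (cochain1 G)"
proof (rule homI)
  fix x assume "x \<in> carrier (cochain0 G)"
  have e: "{v, w} \<in> edges G" if "w \<in> neighbours G v" for v w
    using that by (auto simp: neighbours_def edges_def arcs_ends_conv)
  have "Poly_Mapping.keys (\<Sum>w\<in>neighbours G v. frag_cmul (int (k w)) (frag_of {v, w})) \<subseteq> edges G" for v
    using keys_sum[of "\<lambda>w. frag_cmul (int (k w)) (frag_of {v, w})" "neighbours G v"] e
    by (fastforce simp: keys_frag_of)
  then show "coboundary G k x \<in> carrier (cochain1 G)"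
    using keys_frag_extend[of "\<lambda>v. \<Sum>w\<in>neighbours G v. frag_cmul (int (k w)) (frag_of {v, w})" x]
    by (simp add: coboundary_def cochain1_def) (meson UN_least order_trans)
qed (simp add: coboundary_def cochain0_def cochain1_def frag_extend_add)

lemma coboundary_image_normal: "(coboundary G k ` carrier (cochain0 G)) \<lhd> cochain1 G"
proof -
  interpret C1: comm_group "cochain1 G"
    by (simp add: cochain1_def abelian_free_Abelian_group)
  have "group_hom (cochain0 G) (cochain1 G) (coboundary G k)"
    using coboundary_hom
    by (simp add: group_hom_def group_hom_axioms_def cochain0_def cochain1_def)
  then interpret h: group_hom "cochain0 G" "cochain1 G" "coboundary G k" .
  show ?thesis
    by (simp add: C1.normal_iff_subgroup h.img_is_subgroup)
qed

end

theory Submission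
  imports Defs "HOL-Algebra.Multiplicative_Group"
begin

text \<open>
  The coboundary of \<open>a\<close> has the value \<open>a v * k w + a w * k v\<close> on the edge \<open>{v, w}\<close>. On a tree this
  vanishes on all edges only if the numbers \<open>a v / k v\<close> agree up to a sign that alternates along edges,
  so the kernel has rank one. As a tree has one edge fewer than vertices, the cokernel \<open>H\<^sup>1\<close> is
  finite, and the torsion subgroup is all of it.

  Its order is found by growing the tree leaf by leaf. Let a leaf \<open>l\<close> be attached to the vertex \<open>p\<close> of a
  tree with vertex set \<open>V\<close>, and let \<open>g\<close> be the gcd of the weights on \<open>V\<close>. Modulo the class of the
  new edge, the new cokernel is the old one; so its order is multiplied by the order of that
  class. A multiple \<open>m\<close> of the new edge is a coboundary exactly if \<open>m = a p * k l + a l * k p\<close> where \<open>a\<close>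
  restricts to a cocycle on \<open>V\<close>. The cocycles on \<open>V\<close> are the integer multiples of one with values
  \<open>\<plusminus> k v / g\<close>, hence \<open>a p\<close> runs through the multiples of \<open>k p / g\<close>, while \<open>a l\<close> is arbitrary.
  So the class has order \<open>gcd (k p / g * k l) (k p) = k p / g * gcd (k l) g\<close>
  (\<open>leaf_edge_order_attained\<close>, \<open>leaf_edge_order_dvd\<close>). The factors \<open>gcd (k l) g / g\<close>
  telescope to the gcd of all weights divided by the weight of the first vertex, and the factors \<open>k p\<close>
  together count each vertex once for each edge through which a leaf was attached to it.

  To avoid carrying quotient groups through the induction, the cokernel is represented by a transversal
  of the cochains modulo coboundaries (\<open>grown_tree_transversal\<close>): the transversal for the larger
  tree consists of the old representatives with all values in \<open>{0..<m}\<close> on the new edge.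
  What remains is that a connected graph without cycles of length at least three
  can be grown in this way (\<open>grown_tree_if_tree_graph\<close>) and that \<open>\<Prod>\<^sub>e \<Prod>\<^sub>v\<^sub>\<in>\<^sub>e k v\<close> is
  \<open>\<Prod>\<^sub>v k v ^ u v\<close> for the valences \<open>u\<close> (\<open>prod_edges_eq_prod_valence\<close>).
\<close>

section \<open>Trees grown leaf by leaf, and their zero-cocycles\<close>

inductive grown_tree :: "'a set \<Rightarrow> 'a set set \<Rightarrow> bool" where
  single: "grown_tree {r} {}"
| leaf: "\<lbrakk>grown_tree V E; p \<in> V; l \<notin> V\<rbrakk> \<Longrightarrow> grown_tree (insert l V) (insert {l, p} E)"

lemma grown_tree_finite:
  assumes "grown_tree V E"
  shows "finite V" "finite E"
  using assms by (induction) auto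

lemma grown_tree_edge_subset:
  assumes "grown_tree V E" "e \<in> E"
  shows "e \<subseteq> V"
  using assms by induction auto

text \<open>
  Passing from \<open>p\<close> to \<open>l\<close> along an edge multiplies \<open>a\<close> by \<open>- k l / k p\<close>; absolute values are taken so that
  no bookkeeping of signs is needed.
\<close>

lemma grown_tree_kernel_proportional:
  fixes k :: "'a \<Rightarrow> nat" and a :: "'a \<Rightarrow> int"
  assumes "grown_tree V E" and "\<And>v. v \<in> V \<Longrightarrow> 0 < k v"
    and "\<And>v w. {v, w} \<in> E \<Longrightarrow> a v * int (k w) + a w * int (k v) = 0"
    and "v \<in> V" "w \<in> V"
  shows "\<bar>a v\<bar> * int (k w) = \<bar>a w\<bar> * int (k v)"
  using assms
proof (induction arbitrary: v w rule: grown_tree.induct)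
  case (single r)
  then show ?case by simp
next
  case (leaf V E p l)
  have IH: "\<bar>a v\<bar> * int (k w) = \<bar>a w\<bar> * int (k v)" if "v \<in> V" "w \<in> V" for v w
    using leaf that by blast
  have "a l * int (k p) = - (a p * int (k l))"
    using leaf.prems(2)[of l p] by simp
  then have lp: "\<bar>a l\<bar> * int (k p) = \<bar>a p\<bar> * int (k l)"
    by (metis abs_minus_cancel abs_mult abs_of_nat)
  have lw: "\<bar>a l\<bar> * int (k w) = \<bar>a w\<bar> * int (k l)" if "w \<in> V" for w
  proof -
    have "(\<bar>a l\<bar> * int (k w)) * int (k p) = (\<bar>a l\<bar> * int (k p)) * int (k w)"
      by (simp add: algebra_simps)
    also have "\<dots> = (\<bar>a p\<bar> * int (k w)) * int (k l)"
      unfolding lp by (simp add: algebra_simps)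
    also have "\<dots> = (\<bar>a w\<bar> * int (k l)) * int (k p)"
      unfolding IH[OF \<open>p \<in> V\<close> that] by (simp add: algebra_simps)
    finally show ?thesis
      using leaf.prems(1)[of p] \<open>p \<in> V\<close> by simp
  qed
  show ?case
    using leaf.prems(3,4) IH lw by (auto dest: lw[symmetric])
qed

text \<open>
  By proportionality \<open>k v\<close> divides \<open>\<bar>a v\<bar> * k w\<close> for all \<open>w\<close>, hence \<open>\<bar>a v\<bar>\<close> times the gcd of the
  weights: a cocycle is an integer multiple of the primitive one.
\<close>

lemma grown_tree_kernel_dvd:
  fixes k :: "'a \<Rightarrow> nat" and a :: "'a \<Rightarrow> int"
  assumes "grown_tree V E" and "\<And>v. v \<in> V \<Longrightarrow> 0 < k v"
    and "\<And>v w. {v, w} \<in> E \<Longrightarrow> a v * int (k w) + a w * int (k v) = 0"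
    and "v \<in> V"
  shows "int (k v div Gcd (k ` V)) dvd a v"
proof -
  let ?g = "Gcd (k ` V)"
  have "k v dvd nat \<bar>a v\<bar> * k w" if "w \<in> V" for w
  proof -
    have "int (k v) dvd \<bar>a v\<bar> * int (k w)"
      using grown_tree_kernel_proportional[of V E k a v w] assms that by simp
    then have "int (k v) dvd int (nat \<bar>a v\<bar> * k w)"
      by simp
    then show ?thesis
      by (simp only: of_nat_dvd_iff)
  qed
  then have "k v dvd Gcd ((*) (nat \<bar>a v\<bar>) ` k ` V)"
    by (intro Gcd_greatest) auto
  then have *: "k v dvd nat \<bar>a v\<bar> * ?g"
    by (simp add: Gcd_mult)
  have "?g dvd k v"
    using \<open>v \<in> V\<close> by simp
  then obtain q where q: "k v = ?g * q" ..
  have "?g > 0"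
    using assms(2)[OF \<open>v \<in> V\<close>] q by (metis gr0I mult_0 less_irrefl)
  then have "q dvd nat \<bar>a v\<bar>"
    using * q by (metis mult.commute nat_mult_dvd_cancel1)
  then have "int q dvd int (nat \<bar>a v\<bar>)"
    by (simp only: of_nat_dvd_iff)
  then have "int q dvd a v"
    by simp
  moreover have "k v div ?g = q"
    using q \<open>?g > 0\<close> by (metis nonzero_mult_div_cancel_left less_numeral_extra(3))
  ultimately show ?thesis by (simp only:)
qed

text \<open>
  A tree is bipartite; the signs make \<open>v \<mapsto> \<sigma> v * k v\<close> a cocycle.
\<close>

lemma grown_tree_alternating_sign:
  assumes "grown_tree V E"
  shows "\<exists>\<sigma> :: 'a \<Rightarrow> int. (\<forall>v. \<sigma> v * \<sigma> v = 1) \<and> (\<forall>v w. {v, w} \<in> E \<longrightarrow> \<sigma> v = - \<sigma> w)"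
  using assms
proof induction
  case (single r)
  show ?case by (rule exI[of _ "\<lambda>_. 1"]) simp
next
  case (leaf V E p l)
  then obtain \<sigma> :: "'a \<Rightarrow> int" where \<sigma>: "\<And>v. \<sigma> v * \<sigma> v = 1" "\<And>v w. {v, w} \<in> E \<Longrightarrow> \<sigma> v = - \<sigma> w"
    by blast
  have "v \<noteq> l \<and> w \<noteq> l" if "{v, w} \<in> E" for v w
    using grown_tree_edge_subset[OF leaf.hyps(1) that] \<open>l \<notin> V\<close> by auto
  with \<sigma> leaf.hyps show ?case
    by (intro exI[of _ "\<sigma>(l := - \<sigma> p)"]) (auto simp: doubleton_eq_iff)
qed

section \<open>Transversals of cochains modulo coboundaries\<close>

text \<open>
  Cochains are plain functions here, and values off \<open>E\<close> are irrelevant; this lets the same function serve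
  for a tree and for the larger tree with one more leaf.
\<close>

definition cohomologous :: "('a \<Rightarrow> nat) \<Rightarrow> 'a set set \<Rightarrow> ('a set \<Rightarrow> int) \<Rightarrow> ('a set \<Rightarrow> int) \<Rightarrow> bool" where
  "cohomologous k E x y \<longleftrightarrow>
     (\<exists>a. \<forall>v w. {v, w} \<in> E \<longrightarrow> x {v, w} - y {v, w} = a v * int (k w) + a w * int (k v))"

text \<open>
  Two cochains have a coboundary supported on the new edge: the primitive cocycle of \<open>V\<close>, extended by
  zero and normalised to be positive at \<open>p\<close>, takes the value \<open>k p div Gcd (k ` V) * k l\<close> there, and the
  vertex \<open>l\<close> takes the value \<open>k p\<close>. Bezout's identity combines these two values to their gcd.
\<close>

lemma leaf_edge_order_attained:
  fixes k :: "'a \<Rightarrow> nat"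
  assumes "grown_tree V E" "\<And>v. v \<in> V \<Longrightarrow> 0 < k v" "p \<in> V" "l \<notin> V"
  shows "\<exists>z. (\<forall>v w. {v, w} \<in> E \<longrightarrow> z v * int (k w) + z w * int (k v) = 0) \<and>
    z p * int (k l) + z l * int (k p) = int (k p div Gcd (k ` V) * gcd (k l) (Gcd (k ` V)))"
proof -
  let ?g = "Gcd (k ` V)"
  define q where "q v = k v div ?g" for v
  have q: "int (k v) = int ?g * int (q v)" if "v \<in> V" for v
    using that by (simp add: q_def flip: of_nat_mult)
  obtain \<sigma> :: "'a \<Rightarrow> int" where \<sigma>: "\<And>v. \<sigma> v * \<sigma> v = 1" "\<And>v w. {v, w} \<in> E \<Longrightarrow> \<sigma> v = - \<sigma> w"
    using grown_tree_alternating_sign[OF assms(1)] by blast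
  obtain x y where xy: "x * int (k l) + y * int ?g = int (gcd (k l) ?g)"
    using bezout_int[of "int (k l)" "int ?g"] by (metis gcd_int_int_eq)
  \<comment> \<open>\<open>x\<close> copies of the primitive cocycle with value \<open>k p div ?g\<close> at \<open>p\<close>, and \<open>y\<close> copies of the leaf\<close>
  define z where "z = (\<lambda>v. \<sigma> v * \<sigma> p * x * int (q v))(l := y)"
  have "z v * int (k w) + z w * int (k v) = 0" if "{v, w} \<in> E" for v w
  proof -
    have vw: "v \<in> V" "w \<in> V"
      using grown_tree_edge_subset[OF assms(1) that] by auto
    then have "v \<noteq> l" "w \<noteq> l" using \<open>l \<notin> V\<close> by auto
    have "z v * int (k w) + z w * int (k v) =
        (\<sigma> v + \<sigma> w) * (\<sigma> p * x * int (q v) * int (q w) * int ?g)"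
      unfolding q[OF vw(1)] q[OF vw(2)] z_def using \<open>v \<noteq> l\<close> \<open>w \<noteq> l\<close>
      by (simp add: algebra_simps)
    then show ?thesis
      using \<sigma>(2)[OF that] by simp
  qed
  moreover have "z p * int (k l) + z l * int (k p) = int (k p div ?g * gcd (k l) ?g)"
  proof -
    have "p \<noteq> l" using assms(3,4) by auto
    then have "z p = x * int (q p)"
      by (simp add: z_def \<sigma>(1))
    then have "z p * int (k l) + z l * int (k p) = int (q p) * (x * int (k l) + y * int ?g)"
      unfolding q[OF \<open>p \<in> V\<close>] by (simp add: z_def algebra_simps)
    then show ?thesis
      unfolding xy by (simp add: q_def)
  qed
  ultimately show ?thesis by blast
qed

text \<open>
  Both summands are divisible: the first because \<open>a\<close> is a multiple of the primitive cocycle on \<open>V\<close>,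
  the second because \<open>k p\<close> is a multiple of the stated number.
\<close>

lemma leaf_edge_order_dvd:
  fixes k :: "'a \<Rightarrow> nat"
  assumes "grown_tree V E" "\<And>v. v \<in> V \<Longrightarrow> 0 < k v" "p \<in> V"
    and "\<And>v w. {v, w} \<in> E \<Longrightarrow> a v * int (k w) + a w * int (k v) = 0"
  shows "int (k p div Gcd (k ` V) * gcd (k l) (Gcd (k ` V))) dvd a p * int (k l) + a l * int (k p)"
proof (rule dvd_add)
  let ?g = "Gcd (k ` V)"
  show "int (k p div ?g * gcd (k l) ?g) dvd a p * int (k l)"
    unfolding of_nat_mult using assms
    by (intro mult_dvd_mono grown_tree_kernel_dvd[of V E k a p]) auto
  have "k p div ?g * gcd (k l) ?g dvd k p div ?g * ?g"
    by (intro mult_dvd_mono) auto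
  then have "k p div ?g * gcd (k l) ?g dvd k p"
    using \<open>p \<in> V\<close> by simp
  then show "int (k p div ?g * gcd (k l) ?g) dvd a l * int (k p)"
    by (intro dvd_mult) (simp only: of_nat_dvd_iff)
qed

text \<open>
  Attaching a leaf multiplies the number of representatives by the order \<open>m\<close> of the class of the new
  edge. Multiplying the count by all weights keeps the formula in the natural numbers, and the product over
  the edges gains just the factor \<open>k l * k p\<close> in each step.
\<close>

lemma grown_tree_transversal:
  fixes k :: "'a \<Rightarrow> nat"
  assumes "grown_tree V E" "\<And>v. v \<in> V \<Longrightarrow> 0 < k v"
  shows "\<exists>R. finite R \<and> (\<forall>x. \<exists>!r. r \<in> R \<and> cohomologous k E x r) \<and>
    card R * (\<Prod>v\<in>V. k v) = Gcd (k ` V) * (\<Prod>e\<in>E. \<Prod>v\<in>e. k v)"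
  using assms
proof induction
  case (single r)
  show ?case
    by (rule exI[of _ "{\<lambda>_. 0}"]) (auto simp: cohomologous_def)
next
  case (leaf V E p l)
  let ?g = "Gcd (k ` V)" and ?e = "{l, p}"
  define m where "m = k p div ?g * gcd (k l) ?g"
  have pos: "\<And>v. v \<in> V \<Longrightarrow> 0 < k v" and "0 < k l"
    using leaf.prems by auto
  have "p \<noteq> l" using leaf.hyps by auto
  have off: "v \<noteq> l \<and> w \<noteq> l" if "{v, w} \<in> E" for v w
    using grown_tree_edge_subset[OF leaf.hyps(1) that] \<open>l \<notin> V\<close> by auto
  then have eE: "?e \<notin> E" by auto
  have gp: "?g dvd k p" using \<open>p \<in> V\<close> by simp
  have g0: "0 < ?g" using gp pos[OF \<open>p \<in> V\<close>] by (metis dvd_0_left_iff gr0I less_numeral_extra(3))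
  have "0 < k p div ?g"
    using gp g0 pos[OF \<open>p \<in> V\<close>] by (auto elim!: dvdE)
  then have m0: "0 < m" using \<open>0 < k l\<close> by (simp add: m_def)
  obtain R where "finite R" and R: "\<And>x. \<exists>!r. r \<in> R \<and> cohomologous k E x r"
    and cR: "card R * (\<Prod>v\<in>V. k v) = ?g * (\<Prod>e\<in>E. \<Prod>v\<in>e. k v)"
    using leaf.IH pos by blast
  define R' where "R' = (\<lambda>(r, j). r(?e := int j)) ` (R \<times> {..<m})"
  have refl: "cohomologous k E x y" if "\<And>v w. {v, w} \<in> E \<Longrightarrow> x {v, w} = y {v, w}" for x y
    unfolding cohomologous_def using that by (intro exI[of _ "\<lambda>_. 0"]) auto
  have "inj_on (\<lambda>(r, j). r(?e := int j)) (R \<times> {..<m})"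
  proof (clarsimp simp: inj_on_def)
    fix r j r' j' assume r: "r \<in> R" "r' \<in> R" and eq: "r(?e := int j) = r'(?e := int j')"
    have "r x = r' x" if "x \<noteq> ?e" for x
      using that fun_cong[OF eq, of x] by simp
    then have "cohomologous k E r r'" "cohomologous k E r r"
      using eE by (intro refl; metis)+
    with R[of r] r have "r = r'" by blast
    with fun_cong[OF eq, of ?e] show "r = r' \<and> j = j'" by simp
  qed
  then have cR': "card R' = card R * m"
    by (simp add: R'_def card_image card_cartesian_product)
  have "\<exists>!r. r \<in> R' \<and> cohomologous k (insert ?e E) x r" for x
  proof (rule ex_ex1I)
    obtain r a where "r \<in> R" and a: "\<And>v w. {v, w} \<in> E \<Longrightarrow> x {v, w} - r {v, w} = a v * int (k w) + a w * int (k v)"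
      using R[of x] unfolding cohomologous_def by blast
    obtain z where z: "\<And>v w. {v, w} \<in> E \<Longrightarrow> z v * int (k w) + z w * int (k v) = 0"
      and zm: "z p * int (k l) + z l * int (k p) = int m"
      using leaf_edge_order_attained[of V E k p l] leaf.hyps pos unfolding m_def by blast
    define c where "c = x ?e - a p * int (k l)"
    define j where "j = nat (c mod int m)"
    have j: "j < m" "int j = c mod int m"
      using m0 by (simp_all add: j_def nat_less_iff)
    \<comment> \<open>\<open>a(l := 0)\<close> reduces \<open>x\<close> to \<open>r\<close> off the new edge and to \<open>c\<close> on it; multiples of \<open>z\<close> change only the value
      on the new edge, by multiples of \<open>m\<close>\<close>
    define b where "b v = (a(l := 0)) v + c div int m * z v" for v
    have "x {v, w} - (r(?e := int j)) {v, w} = b v * int (k w) + b w * int (k v)" 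
      if "{v, w} \<in> insert ?e E" for v w
    proof (cases "{v, w} = ?e")
      case True
      have "x ?e - int j = a p * int (k l) + c div int m * int m"
        unfolding j(2) c_def by (simp add: minus_mod_eq_div_mult[symmetric])
      also have "\<dots> = b p * int (k l) + b l * int (k p)"
        unfolding b_def zm[symmetric] using \<open>p \<noteq> l\<close> by (simp add: algebra_simps)
      finally show ?thesis
        using True by (auto simp: doubleton_eq_iff insert_commute)
    next
      case False
      then have "{v, w} \<in> E" using that by simp
      moreover have "b v * int (k w) + b w * int (k v) = a v * int (k w) + a w * int (k v)
          + c div int m * (z v * int (k w) + z w * int (k v))"
        using off[OF \<open>{v, w} \<in> E\<close>] by (simp add: b_def algebra_simps)
      ultimately show ?thesis
        using False a z by simp
    qed
    then have "cohomologous k (insert ?e E) x (r(?e := int j))"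
      unfolding cohomologous_def by blast
    then show "\<exists>r. r \<in> R' \<and> cohomologous k (insert ?e E) x r"
      using \<open>r \<in> R\<close> j(1) unfolding R'_def by force
  next
    fix s t assume s: "s \<in> R' \<and> cohomologous k (insert ?e E) x s"
      and t: "t \<in> R' \<and> cohomologous k (insert ?e E) x t"
    obtain r i where ri: "r \<in> R" "i < m" "s = r(?e := int i)"
      using s by (auto simp: R'_def)
    obtain r' i' where ri': "r' \<in> R" "i' < m" "t = r'(?e := int i')"
      using t by (auto simp: R'_def)
    obtain a where a: "\<And>v w. {v, w} \<in> insert ?e E \<Longrightarrow> x {v, w} - s {v, w} = a v * int (k w) + a w * int (k v)"
      using s unfolding cohomologous_def by blast
    obtain a' where a': "\<And>v w. {v, w} \<in> insert ?e E \<Longrightarrow> x {v, w} - t {v, w} = a' v * int (k w) + a' w * int (k v)"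
      using t unfolding cohomologous_def by blast
    have sr: "s {v, w} = r {v, w}" "t {v, w} = r' {v, w}" if "{v, w} \<in> E" for v w
      using that eE ri(3) ri'(3) by auto
    have "cohomologous k E x r" "cohomologous k E x r'"
      unfolding cohomologous_def using a a' sr by (metis insertI2)+
    then have "r = r'" using R[of x] ri(1) ri'(1) by blast
    \<comment> \<open>\<open>b\<close> is a cocycle on the smaller tree, so its value on the new edge is a multiple of \<open>m\<close>\<close>
    define b where "b v = a' v - a v" for v
    have "b v * int (k w) + b w * int (k v) = 0" if "{v, w} \<in> E" for v w
      using a[of v w] a'[of v w] sr[OF that] that \<open>r = r'\<close> by (simp add: b_def algebra_simps)
    then have "int m dvd b p * int (k l) + b l * int (k p)"
      unfolding m_def using leaf.hyps(1,2) pos by (intro leaf_edge_order_dvd) auto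
    also have "b p * int (k l) + b l * int (k p) = int i - int i'"
      using a[of l p] a'[of l p] ri(3) ri'(3) by (simp add: b_def algebra_simps)
    finally have "int i mod int m = int i' mod int m"
      by (simp add: mod_eq_dvd_iff)
    then have "i = i'" using ri(2) ri'(2) by simp
    then show "s = t" using ri(3) ri'(3) \<open>r = r'\<close> by simp
  qed
  moreover have "card R' * (\<Prod>v\<in>insert l V. k v) =
      Gcd (k ` insert l V) * (\<Prod>e\<in>insert ?e E. \<Prod>v\<in>e. k v)"
  proof -
    note fin = grown_tree_finite[OF leaf.hyps(1)]
    have "card R' * (\<Prod>v\<in>insert l V. k v) = (card R * (\<Prod>v\<in>V. k v)) * (m * k l)"
      using fin leaf.hyps by (simp add: cR' ac_simps)
    also have "\<dots> = (?g * (k p div ?g)) * (gcd (k l) ?g * k l * (\<Prod>e\<in>E. \<Prod>v\<in>e. k v))"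
      unfolding cR m_def by (simp only: ac_simps)
    also have "?g * (k p div ?g) = k p" using gp by simp
    finally show ?thesis
      using fin eE \<open>p \<noteq> l\<close> by (simp add: ac_simps)
  qed
  moreover have "finite R'" using \<open>finite R\<close> by (simp add: R'_def)
  ultimately show ?case by (intro exI[of _ R']) blast
qed

section \<open>Acyclic connected graphs are grown trees\<close>

context graph
begin

lemma adjacent_iff_edge: "u \<rightarrow>\<^bsub>G\<^esub> v \<longleftrightarrow> {u, v} \<in> edges G"
proof
  assume "u \<rightarrow>\<^bsub>G\<^esub> v"
  then show "{u, v} \<in> edges G"
    by (auto simp: edges_def arcs_ends_conv)
next
  assume "{u, v} \<in> edges G"
  then obtain a where "a \<in> arcs G" "{tail G a, head G a} = {u, v}"
    by (auto simp: edges_def)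
  then have "u \<rightarrow>\<^bsub>G\<^esub> v \<or> v \<rightarrow>\<^bsub>G\<^esub> u"
    by (auto simp: doubleton_eq_iff arcs_ends_conv)
  then show "u \<rightarrow>\<^bsub>G\<^esub> v"
    using arcs_ends_symmetric[OF sym_arcs] by blast
qed

lemma edgeE:
  assumes "e \<in> edges G"
  obtains u v where "e = {u, v}" "u \<noteq> v" "u \<in> verts G" "v \<in> verts G"
  using assms no_loops by (auto simp: edges_def)

lemma edge_subset_verts: "e \<in> edges G \<Longrightarrow> e \<subseteq> verts G"
  by (auto elim!: edgeE)

lemma finite_edges: "finite (edges G)"
  by (simp add: edges_def)

lemma neighbours_subset: "neighbours G v \<subseteq> verts G"
  using adj_in_verts by (auto simp: neighbours_def)

lemma finite_neighbours: "finite (neighbours G v)"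
  using neighbours_subset finite_verts by (rule finite_subset)

text \<open>
  A simple path from \<open>p\<close> to \<open>p'\<close> that avoids \<open>l\<close> closes up through \<open>l\<close> to a cycle, which has length at least
  three unless the path is empty.
\<close>

lemma no_long_cycle_unique_neighbour:
  assumes acyclic: "\<not> (\<exists>c. cycle c \<and> 3 \<le> length c)"
    and pq: "awalk p q p'" "set (awalk_verts p q) \<subseteq> S" "l \<notin> S"
    and adj: "{p, l} \<in> edges G" "{p', l} \<in> edges G"
  shows "p = p'"
proof (rule ccontr)
  assume "p \<noteq> p'"
  define q' where "q' = awalk_to_apath q"
  have q': "apath p q' p'"
    unfolding q'_def using pq(1) by (rule apath_awalk_to_apath)
  then have walk: "awalk p q' p'"
    by (rule awalkI_apath)
  have "q' \<noteq> []"
    using walk \<open>p \<noteq> p'\<close> by (auto simp: awalk_Nil_iff)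
  have "set q' \<subseteq> set q"
    unfolding q'_def using pq(1) by (rule awalk_to_apath_subset)
  then have "set (awalk_verts p q') \<subseteq> S"
    using pq(1,2) walk by (auto simp: set_awalk_verts)
  then have "l \<notin> set (awalk_verts p q')"
    using \<open>l \<notin> S\<close> by blast
  obtain a where a: "a \<in> arcs G" "tail G a = l" "head G a = p"
    using adj(1) by (metis adjacent_iff_edge insert_commute reachableE)
  obtain b where b: "b \<in> arcs G" "tail G b = p'" "head G b = l"
    using adj(2) by (metis adjacent_iff_edge reachableE)
  have "awalk l (a # q' @ [b]) l"
    using a b walk by (auto simp: awalk_simps)
  moreover have "distinct (tl (awalk_verts l (a # q' @ [b])))"
  proof -
    have "awalk_verts p (q' @ [b]) = awalk_verts p q' @ [l]"
      using b walk by (auto simp: awalk_verts_conv) 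
    then show ?thesis
      using a q' \<open>l \<notin> set (awalk_verts p q')\<close> by (simp add: apath_def)
  qed
  ultimately have "cycle (a # q' @ [b])"
    unfolding cycle_def by blast
  moreover have "3 \<le> length (a # q' @ [b])"
    using \<open>q' \<noteq> []\<close> by (cases q') auto
  ultimately show False
    using acyclic by blast
qed

text \<open>
  Among the vertex sets that induce a subgraph which is a grown tree and is connected by walks inside the
  set, take a maximal one. If it missed a vertex, some edge would leave it; the
  outer end of that edge has only one neighbour inside, so it can be attached as a leaf.
\<close>

lemma grown_tree_if_tree_graph:
  assumes "tree_graph G"
  shows "grown_tree (verts G) (edges G)"
proof -
  have conn: "strongly_connected G" 
    using assms symmetric_connected_imp_strongly_connected sym_arcs by (auto simp: tree_graph_def)
  have acyclic: "\<not> (\<exists>c. cycle c \<and> 3 \<le> length c)"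
    using assms by (simp add: tree_graph_def)
  define good where "good S \<longleftrightarrow> S \<subseteq> verts G \<and> grown_tree S {e \<in> edges G. e \<subseteq> S} \<and>
    (\<forall>u\<in>S. \<forall>v\<in>S. \<exists>q. awalk u q v \<and> set (awalk_verts u q) \<subseteq> S)" for S
  obtain r where r: "r \<in> verts G"
    using conn by (auto simp: strongly_connected_def)
  have "{e \<in> edges G. e \<subseteq> {r}} = {}"
    by (auto elim!: edgeE)
  moreover have "\<exists>q. awalk r q r \<and> set (awalk_verts r q) \<subseteq> {r}"
    using r by (intro exI[of _ "[]"]) (simp add: awalk_Nil_iff)
  ultimately have "good {r}"
    using r grown_tree.single[of r] unfolding good_def by (metis empty_subsetI insert_subset singletonD)
  then have "finite {S. good S}" "{S. good S} \<noteq> {}"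
    by (auto simp: good_def intro: finite_subset[of _ "Pow (verts G)"])
  then obtain S where S: "good S" and max: "\<And>T. good T \<Longrightarrow> S \<subseteq> T \<Longrightarrow> S = T"
    using finite_has_maximal[of "{S. good S}"] by auto
  have "S = verts G"
  proof (rule ccontr)
    assume "S \<noteq> verts G"
    then obtain t where t: "t \<in> verts G" "t \<notin> S"
      using S by (auto simp: good_def)
    have "S \<noteq> {}"
      using S by (auto simp: good_def elim: grown_tree.cases)
    then obtain s where s: "s \<in> S" "s \<in> verts G"
      using S by (auto simp: good_def)
    have "s \<rightarrow>\<^sup>*\<^bsub>G\<^esub> t"
      using conn s t by (simp add: strongly_connected_def)
    then have "\<exists>p l. p \<in> S \<and> l \<notin> S \<and> p \<rightarrow>\<^bsub>G\<^esub> l"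
      using s(1) t(2) by (induction rule: converse_reachable_induct) blast+
    then obtain p l where pl: "p \<in> S" "l \<notin> S" "p \<rightarrow>\<^bsub>G\<^esub> l"
      by blast
    have SS: "\<exists>q. awalk u q v \<and> set (awalk_verts u q) \<subseteq> S" if "u \<in> S" "v \<in> S" for u v
      using S that unfolding good_def by blast
    have only: "p' = p" if p': "{p', l} \<in> edges G" "p' \<in> S" for p'
    proof -
      obtain q where "awalk p' q p" "set (awalk_verts p' q) \<subseteq> S"
        using SS pl(1) p'(2) by blast
      then show ?thesis
        using no_long_cycle_unique_neighbour[OF acyclic] pl p' adjacent_iff_edge by blast
    qed
    have "{e \<in> edges G. e \<subseteq> insert l S} = insert {l, p} {e \<in> edges G. e \<subseteq> S}"
    proof (intro equalityI subsetI)
      fix e assume e: "e \<in> {e \<in> edges G. e \<subseteq> insert l S}"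
      show "e \<in> insert {l, p} {e \<in> edges G. e \<subseteq> S}"
      proof (cases "l \<in> e")
        case True
        then obtain p' where p': "e = {p', l}" "p' \<noteq> l"
          using e by (auto elim!: edgeE)
        then have "p' = p"
          using e only by auto
        then show ?thesis using p' by (simp add: insert_commute)
      qed (use e in auto)
    next
      fix e assume "e \<in> insert {l, p} {e \<in> edges G. e \<subseteq> S}"
      then show "e \<in> {e \<in> edges G. e \<subseteq> insert l S}"
        using pl by (auto simp: adjacent_iff_edge insert_commute)
    qed
    then have tree: "grown_tree (insert l S) {e \<in> edges G. e \<subseteq> insert l S}"
      using S pl by (auto simp: good_def intro: grown_tree.leaf)
    obtain a where a: "a \<in> arcs G" "tail G a = p" "head G a = l"
      using pl(3) by (rule reachableE)
    obtain b where b: "b \<in> arcs G" "tail G b = l" "head G b = p"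
      using pl(3) arcs_ends_symmetric[OF sym_arcs] by (meson reachableE)
    have l: "l \<in> verts G" using a by auto
    have "\<exists>q. awalk u q v \<and> set (awalk_verts u q) \<subseteq> insert l S"
      if uv: "u \<in> insert l S" "v \<in> insert l S" for u v
    proof -
      consider "u \<in> S" "v \<in> S" | "u = l" "v = l" | "u = l" "v \<in> S" | "u \<in> S" "v = l"
        using uv by blast
      then show ?thesis
      proof cases
        case 1
        then show ?thesis using SS by blast
      next
        case 2
        then show ?thesis using l by (intro exI[of _ "[]"]) (auto simp: awalk_Nil_iff)
      next
        case 3
        then obtain q where "awalk p q v" "set (awalk_verts p q) \<subseteq> S"
          using SS pl by blast
        then show ?thesis
          using 3 b by (intro exI[of _ "b # q"]) (auto simp: awalk_Cons_iff)
      next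
        case 4
        then obtain q where q: "awalk u q p" "set (awalk_verts u q) \<subseteq> S"
          using SS pl by blast
        then have w: "awalk u (q @ [a]) l"
          using a l by (auto simp: awalk_simps)
        then show ?thesis
          using 4 q a w pl(1) by (intro exI[of _ "q @ [a]"]) (auto simp: set_awalk_verts)
      qed
    qed
    then have "good (insert l S)"
      using S l tree by (auto simp: good_def)
    then have "S = insert l S"
      by (rule max) blast
    then show False
      using pl by blast
  qed
  moreover have "{e \<in> edges G. e \<subseteq> verts G} = edges G"
    using edge_subset_verts by blast
  ultimately show ?thesis
    using S by (simp add: good_def)
qed

section \<open>Valences and the coboundary in coordinates\<close>

lemma valence_eq_card_incident_edges: "valence G v = card {e \<in> edges G. v \<in> e}"
proof -
  have "bij_betw (\<lambda>w. {v, w}) (neighbours G v) {e \<in> edges G. v \<in> e}"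
  proof (rule bij_betw_imageI)
    show "inj_on (\<lambda>w. {v, w}) (neighbours G v)"
      by (auto simp: inj_on_def doubleton_eq_iff)
    have "\<exists>w \<in> neighbours G v. e = {v, w}" if "e \<in> edges G" "v \<in> e" for e
    proof -
      have "\<exists>w. e = {v, w}"
        using that by (auto elim!: edgeE)
      then show ?thesis
        using that by (auto simp: neighbours_def adjacent_iff_edge)
    qed
    then show "(\<lambda>w. {v, w}) ` neighbours G v = {e \<in> edges G. v \<in> e}"
      by (auto simp: neighbours_def adjacent_iff_edge)
  qed
  then show ?thesis
    by (simp add: valence_def bij_betw_same_card)
qed

text \<open>
  Double counting of incident pairs of a vertex and an edge.
\<close>

lemma prod_edges_eq_prod_valence:
  fixes k :: "'a \<Rightarrow> 'c :: comm_monoid_mult"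
  shows "(\<Prod>e\<in>edges G. \<Prod>v\<in>e. k v) = (\<Prod>v\<in>verts G. k v ^ valence G v)"
proof -
  have "(\<Prod>e\<in>edges G. \<Prod>v\<in>e. k v) = (\<Prod>e\<in>edges G. \<Prod>v | v \<in> verts G \<and> v \<in> e. k v)"
    using edge_subset_verts by (intro prod.cong) blast+
  also have "\<dots> = (\<Prod>v\<in>verts G. \<Prod>e | e \<in> edges G \<and> v \<in> e. k v)"
    by (rule prod.swap_restrict) (auto simp: finite_edges)
  finally show ?thesis
    by (simp add: valence_eq_card_incident_edges)
qed

text \<open>
  The edge \<open>{v, w}\<close> occurs only in the coboundaries of its two ends. This formula is what connects
  the differential on formal sums with \<^const>\<open>cohomologous\<close>.
\<close>

lemma lookup_coboundary:
  assumes "{v, w} \<in> edges G"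
  shows "poly_mapping.lookup (coboundary G k a) {v, w} = poly_mapping.lookup a v * int (k w) + poly_mapping.lookup a w * int (k v)"
proof -
  have vw: "v \<noteq> w" "w \<in> neighbours G v" "v \<in> neighbours G w"
    using assms adjacent_iff_edge[of v w] adjacent_iff_edge[of w v]
    by (auto simp: neighbours_def insert_commute dest: adj_not_same)
  let ?d = "\<lambda>u. \<Sum>x\<in>neighbours G u. int (k x) * (if {u, x} = {v, w} then 1 else 0)"
  have d: "?d u = (if u = v then int (k w) else 0) + (if u = w then int (k v) else 0)" for u
  proof -
    have "?d u = (\<Sum>x\<in>neighbours G u. (if x = w then if u = v then int (k w) else 0 else 0)
        + (if x = v then if u = w then int (k v) else 0 else 0))"
      using vw(1) by (intro sum.cong) (auto simp: doubleton_eq_iff)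
    then show ?thesis
      using vw by (auto simp: sum.distrib finite_neighbours)
  qed
  have "poly_mapping.lookup (coboundary G k a) {v, w} = (\<Sum>u\<in>Poly_Mapping.keys a. poly_mapping.lookup a u * ?d u)"
    unfolding coboundary_def frag_extend_def by (simp add: lookup_sum lookup_frag_of eq_commute)
  also have "\<dots> = (\<Sum>u\<in>Poly_Mapping.keys a \<union> {v, w}. poly_mapping.lookup a u * ?d u)"
    by (intro sum.mono_neutral_left) (auto simp: in_keys_iff)
  also have "\<dots> = poly_mapping.lookup a v * int (k w) + poly_mapping.lookup a w * int (k v)"
    unfolding d by (simp add: distrib_left sum.distrib if_distrib[of "(*) _"] cong: if_cong)
  finally show ?thesis .
qed

end

section \<open>From transversals to the first cohomology group\<close>

lemma torsion_subgroup_finite_group: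
  assumes "group A" "finite (carrier A)"
  shows "torsion_subgroup A = carrier A"
proof -
  interpret group A by fact
  have "0 < order A"
    using assms(2) by (simp add: order_gt_0_iff_finite)
  then show ?thesis
    unfolding torsion_subgroup_def using pow_order_eq_1 by blast
qed

text \<open>
  Cutting off to \<open>S\<close> makes any function finitely supported if \<open>S\<close> is finite.
\<close>

definition cochain_of_fun :: "'e set \<Rightarrow> ('e \<Rightarrow> int) \<Rightarrow> ('e \<Rightarrow>\<^sub>0 int)" where
  "cochain_of_fun S x = Abs_poly_mapping (\<lambda>e. if e \<in> S then x e else 0)"

lemma lookup_cochain_of_fun:
  assumes "finite S"
  shows "poly_mapping.lookup (cochain_of_fun S x) e = (if e \<in> S then x e else 0)"
proof -
  have "{e. (if e \<in> S then x e else 0) \<noteq> (0 :: int)} \<subseteq> S"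
    by (rule subsetI) (simp split: if_splits)
  then have "finite {e. (if e \<in> S then x e else 0) \<noteq> (0 :: int)}"
    using assms by (rule finite_subset)
  then have "(\<lambda>e. if e \<in> S then x e else 0) \<in> {f :: _ \<Rightarrow> int. finite {e. f e \<noteq> 0}}"
    by (subst mem_Collect_eq)
  then show ?thesis
    unfolding cochain_of_fun_def by (simp only: Abs_poly_mapping_inverse)
qed

lemma keys_cochain_of_fun:
  assumes "finite S"
  shows "Poly_Mapping.keys (cochain_of_fun S x) \<subseteq> S"
proof
  fix e assume "e \<in> Poly_Mapping.keys (cochain_of_fun S x)"
  then have "poly_mapping.lookup (cochain_of_fun S x) e \<noteq> 0"
    by (simp only: in_keys_iff not_False_eq_True)
  then show "e \<in> S"
    unfolding lookup_cochain_of_fun[OF assms] by (metis (full_types))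
qed

context graph
begin

lemma cohomologous_iff_in_image:
  assumes "Poly_Mapping.keys x \<subseteq> edges G" "Poly_Mapping.keys y \<subseteq> edges G"
  shows "cohomologous k (edges G) (poly_mapping.lookup x) (poly_mapping.lookup y) \<longleftrightarrow>
    x - y \<in> coboundary G k ` carrier (cochain0 G)"
proof
  assume "cohomologous k (edges G) (poly_mapping.lookup x) (poly_mapping.lookup y)"
  then obtain a where a: "\<And>v w. {v, w} \<in> edges G \<Longrightarrow>
      poly_mapping.lookup x {v, w} - poly_mapping.lookup y {v, w} = a v * int (k w) + a w * int (k v)"
    unfolding cohomologous_def by blast
  let ?a = "cochain_of_fun (verts G) a"
  have a0: "?a \<in> carrier (cochain0 G)"
    by (simp add: cochain0_def keys_cochain_of_fun)
  then have "coboundary G k ?a \<in> carrier (cochain1 G)"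
    using coboundary_hom by (rule hom_in_carrier[rotated])
  then have keys: "Poly_Mapping.keys (coboundary G k ?a) \<subseteq> edges G"
    by (simp add: cochain1_def)
  have "x - y = coboundary G k ?a"
  proof (rule poly_mapping_eqI)
    fix e
    show "poly_mapping.lookup (x - y) e = poly_mapping.lookup (coboundary G k ?a) e"
    proof (cases "e \<in> edges G")
      case True
      then obtain v w where vw: "e = {v, w}" "v \<in> verts G" "w \<in> verts G"
        by (auto elim: edgeE)
      then show ?thesis
        using True a[of v w] by (simp add: lookup_minus lookup_coboundary lookup_cochain_of_fun)
    next
      case False
      then have "e \<notin> Poly_Mapping.keys x" "e \<notin> Poly_Mapping.keys y"
        "e \<notin> Poly_Mapping.keys (coboundary G k ?a)"
        using assms keys by auto
      then show ?thesis
        by (simp add: lookup_minus not_in_keys_iff_lookup_eq_zero)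
    qed
  qed
  then show "x - y \<in> coboundary G k ` carrier (cochain0 G)"
    using a0 by blast
next
  assume "x - y \<in> coboundary G k ` carrier (cochain0 G)"
  then obtain a where "x - y = coboundary G k a"
    by blast
  then show "cohomologous k (edges G) (poly_mapping.lookup x) (poly_mapping.lookup y)"
    unfolding cohomologous_def
    by (intro exI[of _ "poly_mapping.lookup a"]) (metis lookup_coboundary lookup_minus)
qed

lemma cohomologous_restrict:
  "cohomologous k (edges G) x (poly_mapping.lookup (cochain_of_fun (edges G) r)) \<longleftrightarrow>
   cohomologous k (edges G) x r"
  unfolding cohomologous_def by (simp add: lookup_cochain_of_fun finite_edges)

text \<open>
  Two cochains lie in the same coset of the group of coboundaries exactly if they are cohomologous, so
  the unique representatives in \<open>R\<close> enumerate the cosets.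
\<close>

lemma bij_betw_transversal_cohomology1:
  assumes R: "\<And>x. \<exists>!r. r \<in> R \<and> cohomologous k (edges G) x r"
  shows "bij_betw (\<lambda>r. (coboundary G k ` carrier (cochain0 G)) #>\<^bsub>cochain1 G\<^esub> cochain_of_fun (edges G) r)
    R (carrier (cohomology1 G k))"
proof -
  let ?H = "coboundary G k ` carrier (cochain0 G)"
  let ?f = "cochain_of_fun (edges G)"
  have H: "?H \<lhd> cochain1 G" by (rule coboundary_image_normal)
  interpret C1: group "cochain1 G"
    by (simp add: cochain1_def)
  have sub: "subgroup ?H (cochain1 G)"
    using H by (rule normal_imp_subgroup)
  have f: "?f r \<in> carrier (cochain1 G)" for r
    by (simp add: cochain1_def keys_cochain_of_fun finite_edges)
  have coset_eq: "?H #>\<^bsub>cochain1 G\<^esub> x = ?H #>\<^bsub>cochain1 G\<^esub> y \<longleftrightarrow>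
      cohomologous k (edges G) (poly_mapping.lookup x) (poly_mapping.lookup y)"
    if "x \<in> carrier (cochain1 G)" "y \<in> carrier (cochain1 G)" for x y
  proof -
    have keys: "Poly_Mapping.keys x \<subseteq> edges G" "Poly_Mapping.keys y \<subseteq> edges G"
      using that by (simp_all add: cochain1_def)
    have "x \<in> ?H #>\<^bsub>cochain1 G\<^esub> y \<longleftrightarrow> x - y \<in> ?H"
      unfolding r_coset_def cochain1_def by (auto simp: algebra_simps intro: rev_image_eqI)
    moreover have "?H #>\<^bsub>cochain1 G\<^esub> x = ?H #>\<^bsub>cochain1 G\<^esub> y \<longleftrightarrow> x \<in> ?H #>\<^bsub>cochain1 G\<^esub> y"
      using that sub C1.rcos_self C1.repr_independence by metis
    ultimately show ?thesis
      using cohomologous_iff_in_image[OF keys] by blast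
  qed
  have coset_rep: "?H #>\<^bsub>cochain1 G\<^esub> x = ?H #>\<^bsub>cochain1 G\<^esub> ?f r \<longleftrightarrow>
      cohomologous k (edges G) (poly_mapping.lookup x) r" if "x \<in> carrier (cochain1 G)" for x r
    using coset_eq[OF that f] by (simp add: cohomologous_restrict)
  show ?thesis
  proof (rule bij_betw_imageI)
    show "inj_on (\<lambda>r. ?H #>\<^bsub>cochain1 G\<^esub> ?f r) R"
    proof (rule inj_onI)
      fix r s assume rs: "r \<in> R" "s \<in> R" "?H #>\<^bsub>cochain1 G\<^esub> ?f r = ?H #>\<^bsub>cochain1 G\<^esub> ?f s"
      let ?x = "poly_mapping.lookup (?f r)"
      have "cohomologous k (edges G) ?x r" "cohomologous k (edges G) ?x s"
        using coset_rep[OF f] rs(3) by blast+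
      then show "r = s"
        using R[of ?x] rs(1,2) by blast
    qed
    have "\<exists>r\<in>R. ?H #>\<^bsub>cochain1 G\<^esub> x = ?H #>\<^bsub>cochain1 G\<^esub> ?f r" if "x \<in> carrier (cochain1 G)" for x
      using R[of "poly_mapping.lookup x"] coset_rep[OF that] by blast
    then show "(\<lambda>r. ?H #>\<^bsub>cochain1 G\<^esub> ?f r) ` R = carrier (cohomology1 G k)"
      unfolding cohomology1_def carrier_FactGroup using f by blast
  qed
qed

end

theorem lemma54:
  fixes G :: "('a, 'b) pre_digraph" and k :: "'a \<Rightarrow> nat"
  assumes "tree_graph G"
    and "\<And>v. v \<in> verts G \<Longrightarrow> 0 < k v"
  shows "(of_nat (card (torsion_subgroup (cohomology1 G k))) :: rat) =
    of_nat (Gcd (k ` verts G)) * (\<Prod>v\<in>verts G. of_nat (k v) powi (int (valence G v) - 1))"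
proof -
  interpret graph G
    using assms(1) by (simp only: tree_graph_def)
  have "\<exists>R. finite R \<and> (\<forall>x. \<exists>!r. r \<in> R \<and> cohomologous k (edges G) x r) \<and>
      card R * (\<Prod>v\<in>verts G. k v) = Gcd (k ` verts G) * (\<Prod>e\<in>edges G. \<Prod>v\<in>e. k v)"
    using grown_tree_if_tree_graph[OF assms(1)] assms(2) by (rule grown_tree_transversal)
  then obtain R where "finite R" and R: "\<And>x. \<exists>!r. r \<in> R \<and> cohomologous k (edges G) x r"
    and card_R: "card R * (\<Prod>v\<in>verts G. k v) = Gcd (k ` verts G) * (\<Prod>e\<in>edges G. \<Prod>v\<in>e. k v)"
    by (elim exE conjE) (rule that, auto)
  have bij: "bij_betw (\<lambda>r. (coboundary G k ` carrier (cochain0 G)) #>\<^bsub>cochain1 G\<^esub> cochain_of_fun (edges G) r)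
      R (carrier (cohomology1 G k))"
    by (rule bij_betw_transversal_cohomology1[OF R])
  have "group (cohomology1 G k)"
    unfolding cohomology1_def by (rule normal.factorgroup_is_group[OF coboundary_image_normal])
  moreover have "finite (carrier (cohomology1 G k))"
    using bij_betw_finite[OF bij] \<open>finite R\<close> by blast
  ultimately have card: "card (torsion_subgroup (cohomology1 G k)) = card R"
    using bij_betw_same_card[OF bij] by (simp add: torsion_subgroup_finite_group)
  \<comment> \<open>Dividing by the product of the weights lowers each exponent by one, possibly to \<open>-1\<close>.\<close>
  have pos: "(\<Prod>v\<in>verts G. of_nat (k v) :: rat) \<noteq> 0"
    using assms(2) by (force simp: prod_zero_iff)
  have "(of_nat (card R) :: rat) * (\<Prod>v\<in>verts G. of_nat (k v)) =
      of_nat (Gcd (k ` verts G)) * (\<Prod>v\<in>verts G. of_nat (k v) ^ valence G v)"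
    using arg_cong[OF card_R, of "of_nat :: nat \<Rightarrow> rat"] by (simp add: prod_edges_eq_prod_valence)
  also have "(\<Prod>v\<in>verts G. (of_nat (k v) :: rat) ^ valence G v) =
      (\<Prod>v\<in>verts G. of_nat (k v) powi (int (valence G v) - 1) * of_nat (k v))"
    using assms(2) by (intro prod.cong refl) (simp add: power_int_diff)
  finally show ?thesis
    using pos unfolding card by (simp add: prod.distrib)
qed

end
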